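(* Let $T$ be a Leibniz triple system and $U(T)$ the universal Leibniz envelope of $T$. Then there is a unique involutive automorphism $\theta: U(T)\rightarrow U(T)$ such that $T=\{x\in U(T)\mid \theta(x)=-x\}$.
   Context: All vector spaces are finite-dimensional over a fixed field $\mathbb{K}$ of characteristic $0$. A Leibniz triple system is a vector space $T$ with a trilinear operation $\{\cdot,\cdot,\cdot\}:T\times T\times T\to T$ satisfying, for all $a,b,c,d,e\in T$, $\{a\{bcd\}e\}=\{\{abc\}de\}-\{\{acb\}de\}-\{\{adb\}ce\}+\{\{adc\}be\}$ and $\{ab\{cde\}\}=\{\{abc\}de\}-\{\{abd\}ce\}-\{\{abe\}cd\}+\{\{abe\}dc\}$. A (right) Leibniz algebra is a vector space with a bilinear bracket satisfying $[[x,y],z]=[[x,z],y]+[x,[y,z]]$. The universal Leibniz envelope of $T$ is the Leibniz algebra $U(T)=T\oplus(T\otimes T)$ with bilinear bracket given by $[a,b]=a\otimes b$, $[a\otimes b,c]=\{abc\}$, $[a,b\otimes c]=\{abc\}-\{acb\}$, $[a\otimes b,c\otimes d]=\{abc\}\otimes d-\{abd\}\otimes c$ for $a,b,c,d\in T$. $T$ is identified with the first summand. An involutive automorphism is a Leibniz algebra automorphism $\theta$ with $\theta^2=\mathrm{id}$. *)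

theory Defs
  imports "HOL-Analysis.Product_Vector"
begin

section \<open>Bilinear maps and tensor products\<close>

definition is_bilinear ::
  "('k::field \<Rightarrow> 'a::ab_group_add \<Rightarrow> 'a) \<Rightarrow> ('k \<Rightarrow> 'b::ab_group_add \<Rightarrow> 'b) \<Rightarrow>
   ('k \<Rightarrow> 'c::ab_group_add \<Rightarrow> 'c) \<Rightarrow> ('a \<Rightarrow> 'b \<Rightarrow> 'c) \<Rightarrow> bool"
  where "is_bilinear s1 s2 s3 f \<longleftrightarrow>
    (\<forall>a. Vector_Spaces.linear s2 s3 (\<lambda>b. f a b)) \<and> (\<forall>b. Vector_Spaces.linear s1 s3 (\<lambda>a. f a b))"

text \<open>A tensor product of two vector spaces is a vector space with a universal bilinear map.
  A locale assumption cannot quantify over the type of the target space, so the universal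
  property is assumed for scalar-valued bilinear maps only. Over a field this already yields the
  universal property for every target space, see lemma \<open>universal\<close> below.\<close>

locale tensor_product =
  V1: vector_space s1 + V2: vector_space s2 + W: vector_space sW
  for s1 :: "'k::field \<Rightarrow> 'a::ab_group_add \<Rightarrow> 'a"
    and s2 :: "'k \<Rightarrow> 'b::ab_group_add \<Rightarrow> 'b"
    and sW :: "'k \<Rightarrow> 'w::ab_group_add \<Rightarrow> 'w" +
  fixes tensor :: "'a \<Rightarrow> 'b \<Rightarrow> 'w"
  assumes bilinear_tensor: "is_bilinear s1 s2 sW tensor"
    and universal_scalar: "is_bilinear s1 s2 (*) f \<Longrightarrow>
      \<exists>!g. Vector_Spaces.linear sW (*) g \<and> (\<forall>a b. g (tensor a b) = f a b)"

text \<open>The linear map on the tensor product that is induced by a bilinear map \<open>f\<close>.\<close>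

definition tensor_lift ::
  "('k::field \<Rightarrow> 'w::ab_group_add \<Rightarrow> 'w) \<Rightarrow> ('a \<Rightarrow> 'b \<Rightarrow> 'w) \<Rightarrow>
   ('k \<Rightarrow> 'c::ab_group_add \<Rightarrow> 'c) \<Rightarrow> ('a \<Rightarrow> 'b \<Rightarrow> 'c) \<Rightarrow> 'w \<Rightarrow> 'c"
  where "tensor_lift sW tensor sC f =
    (THE g. Vector_Spaces.linear sW sC g \<and> (\<forall>a b. g (tensor a b) = f a b))"

lemma vector_space_field: "vector_space ((*) :: 'k::field \<Rightarrow> 'k \<Rightarrow> 'k)"
  by unfold_locales (simp_all add: algebra_simps)

lemma (in vector_space) separating_functional:
  assumes "v \<notin> span S"
  obtains g where "Vector_Spaces.linear scale (*) g" "g v = 1" "\<And>x. x \<in> span S \<Longrightarrow> g x = 0"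
proof -
  interpret K: vector_space "(*) :: 'a \<Rightarrow> 'a \<Rightarrow> 'a" by (rule vector_space_field)
  interpret P: vector_space_pair scale "(*) :: 'a \<Rightarrow> 'a \<Rightarrow> 'a" by unfold_locales
  obtain B where B: "B \<subseteq> S" "independent B" "S \<subseteq> span B"
    using maximal_independent_subset by blast
  have sp: "span B = span S"
    by (metis B(1,3) span_minimal span_mono subset_antisym subspace_span)
  have ind: "independent (insert v B)"
    using B(2) assms sp by (simp add: independent_insertI)
  let ?g = "P.construct (insert v B) (\<lambda>b. if b = v then 1 else 0)"
  have lin: "Vector_Spaces.linear scale (*) ?g"
    by (rule P.linear_construct[OF ind])
  have "v \<notin> B"
    using assms sp span_base by blast
  then have "?g b = 0" if "b \<in> B" for b
    using that by (auto simp: P.construct_basis[OF ind])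
  then have "?g x = 0" if "x \<in> span S" for x
    using P.linear_eq_0_on_span[OF lin, of B] that sp by blast
  moreover have "?g v = 1"
    by (simp add: P.construct_basis[OF ind])
  ultimately show ?thesis
    using lin that by blast
qed

context tensor_product
begin

lemma span_tensor: "W.span (range (case_prod tensor)) = UNIV"
proof (rule ccontr)
  assume "W.span (range (case_prod tensor)) \<noteq> UNIV"
  then obtain v where "v \<notin> W.span (range (case_prod tensor))" by blast
  then obtain g where g: "Vector_Spaces.linear sW (*) g" "g v = 1"
    "\<And>x. x \<in> W.span (range (case_prod tensor)) \<Longrightarrow> g x = 0"
    by (rule W.separating_functional) blast
  interpret K: vector_space "(*) :: 'k \<Rightarrow> 'k \<Rightarrow> 'k" by (rule vector_space_field)
  have z: "Vector_Spaces.linear sW (*) (\<lambda>_. 0 :: 'k)"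
    "is_bilinear s1 s2 (*) (\<lambda>_ _. 0 :: 'k)"
    unfolding is_bilinear_def Vector_Spaces.linear_iff
    by (simp_all add: W.vector_space_axioms V1.vector_space_axioms
      V2.vector_space_axioms K.vector_space_axioms)
  have "g (tensor a b) = 0" for a b
    by (rule g(3)) (auto intro!: W.span_base)
  then have "g = (\<lambda>_. 0)"
    using universal_scalar[OF z(2)] g(1) z(1) by blast
  then show False
    using g(2) by simp
qed

lemma linear_ext_tensor:
  assumes "Vector_Spaces.linear sW sC g" "Vector_Spaces.linear sW sC h"
    and "\<And>a b. g (tensor a b) = h (tensor a b)"
  shows "g = h"
proof
  fix x
  interpret g: Vector_Spaces.linear sW sC g by fact
  interpret P: vector_space_pair sW sC by unfold_locales
  show "g x = h x"
    by (rule P.linear_eq_on_span[OF assms(1,2), of "range (case_prod tensor)"])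
      (use assms(3) span_tensor in auto)
qed

lemma universal:
  fixes sC :: "'k \<Rightarrow> 'c::ab_group_add \<Rightarrow> 'c"
  assumes C: "vector_space sC" and f: "is_bilinear s1 s2 sC f"
  shows "\<exists>!g. Vector_Spaces.linear sW sC g \<and> (\<forall>a b. g (tensor a b) = f a b)"
proof -
  interpret C: vector_space sC by fact
  interpret P: vector_space_pair sW sC by unfold_locales
  obtain B where B: "B \<subseteq> range (case_prod tensor)" "W.independent B"
    "range (case_prod tensor) \<subseteq> W.span B"
    using W.maximal_independent_subset by blast
  have spB: "W.span B = UNIV"
    using B(3) span_tensor W.span_minimal[OF _ W.subspace_span] by blast
  have "\<forall>x\<in>B. \<exists>p. x = case_prod tensor p" using B(1) by blast
  then obtain p where p: "\<And>x. x \<in> B \<Longrightarrow> x = case_prod tensor (p x)" by metis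
  define g where "g = P.construct B (\<lambda>x. case_prod f (p x))"
  have lin: "Vector_Spaces.linear sW sC g"
    unfolding g_def by (rule P.linear_construct[OF B(2)])
  have "g (tensor a b) = f a b" for a b
  proof (rule ccontr)
    assume "g (tensor a b) \<noteq> f a b"
    then have "g (tensor a b) - f a b \<notin> C.span {}" by simp
    then obtain l where l: "Vector_Spaces.linear sC (*) l" "l (g (tensor a b) - f a b) = 1"
      by (rule C.separating_functional) blast
    interpret l: Vector_Spaces.linear sC "(*)" l by fact
    interpret Q: vector_space_pair sW "(*) :: 'k \<Rightarrow> 'k \<Rightarrow> 'k" by unfold_locales
    have "is_bilinear s1 s2 (*) (\<lambda>a b. l (f a b))"
      using f l(1) Vector_Spaces.linear_compose[of s1 sC _ "(*)" l]
        Vector_Spaces.linear_compose[of s2 sC _ "(*)" l]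
      unfolding is_bilinear_def comp_def by blast
    from universal_scalar[OF this] obtain h where
      h: "Vector_Spaces.linear sW (*) h" "\<And>a b. h (tensor a b) = l (f a b)" by blast
    have lg: "Vector_Spaces.linear sW (*) (\<lambda>x. l (g x))"
      using Vector_Spaces.linear_compose[OF lin l(1)] by (simp add: comp_def)
    have "h x = l (g x)" if "x \<in> B" for x
    proof -
      have "g x = case_prod f (p x)"
        unfolding g_def using that by (rule P.construct_basis[OF B(2)])
      moreover have "h x = l (case_prod f (p x))"
        using h(2) p[OF that] by (metis case_prod_beta)
      ultimately show ?thesis by simp
    qed
    then have "h (tensor a b) = l (g (tensor a b))"
      by (rule Q.linear_eq_on_span[OF h(1) lg, of B]) (auto simp: spB)
    then show False
      using h(2) l(2) by (simp add: l.diff)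
  qed
  then show ?thesis
    using lin linear_ext_tensor[of sC] by (intro ex_ex1I) auto
qed

lemma
  assumes "vector_space sC" and "is_bilinear s1 s2 sC f"
  shows linear_tensor_lift: "Vector_Spaces.linear sW sC (tensor_lift sW tensor sC f)"
    and tensor_lift_tensor: "tensor_lift sW tensor sC f (tensor a b) = f a b"
  using theI'[OF universal[OF assms]] unfolding tensor_lift_def by blast+

end


section \<open>Leibniz triple systems and their universal Leibniz envelopes\<close>

locale leibniz_triple_system = vector_space sT
  for sT :: "'k::field_char_0 \<Rightarrow> 't::ab_group_add \<Rightarrow> 't" +
  fixes triple :: "'t \<Rightarrow> 't \<Rightarrow> 't \<Rightarrow> 't"
  assumes finite_dimensional: "\<exists>B. finite B \<and> span B = UNIV"
    and linear_triple1: "Vector_Spaces.linear sT sT (\<lambda>a. triple a b c)"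
    and linear_triple2: "Vector_Spaces.linear sT sT (\<lambda>b. triple a b c)"
    and linear_triple3: "Vector_Spaces.linear sT sT (\<lambda>c. triple a b c)"
    and triple_middle: "triple a (triple b c d) e =
      triple (triple a b c) d e - triple (triple a c b) d e
      - triple (triple a d b) c e + triple (triple a d c) b e"
    and triple_right: "triple a b (triple c d e) =
      triple (triple a b c) d e - triple (triple a b d) c e
      - triple (triple a b e) c d + triple (triple a b e) d c"

text \<open>The underlying space of \<open>U(T) = T \<oplus> (T \<otimes> T)\<close> is the product type \<open>'t \<times> 'w\<close>, where
  \<open>'w\<close> carries the tensor square of \<open>T\<close>; scalars act by \<^const>\<open>module_prod.scale\<close>. The bracket is
  the bilinear extension of the defining equations on \<open>T\<close> and on pure tensors, which are recovered
  as \<open>envelope_bracket_gens\<close> below.\<close>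

definition envelope_bracket ::
  "('k::field \<Rightarrow> 't::ab_group_add \<Rightarrow> 't) \<Rightarrow> ('t \<Rightarrow> 't \<Rightarrow> 't \<Rightarrow> 't) \<Rightarrow>
   ('k \<Rightarrow> 'w::ab_group_add \<Rightarrow> 'w) \<Rightarrow> ('t \<Rightarrow> 't \<Rightarrow> 'w) \<Rightarrow> 't \<times> 'w \<Rightarrow> 't \<times> 'w \<Rightarrow> 't \<times> 'w"
  where "envelope_bracket sT triple sW tensor = (\<lambda>(a, u) (c, v).
    (tensor_lift sW tensor sT (\<lambda>x y. triple x y c) u
       + tensor_lift sW tensor sT (\<lambda>y z. triple a y z - triple a z y) v,
     tensor a c
       + tensor_lift sW tensor sW
           (\<lambda>x y. tensor_lift sW tensor sW
             (\<lambda>z w. tensor (triple x y z) w - tensor (triple x y w) z) v) u))"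

text \<open>A Leibniz algebra automorphism is a bijective linear map that preserves the bracket. The
  definition refers to the bracket only and deliberately does not demand that it satisfies the
  Leibniz identity: with the full tensor square as second summand, the bracket of \<open>U(T)\<close> does so
  only if the relation in \<open>leibniz_identity_imp\<close> below holds in \<open>T \<otimes> T\<close>, which is not the case
  for every Leibniz triple system.\<close>

definition algebra_automorphism ::
  "('k::field \<Rightarrow> 'u::ab_group_add \<Rightarrow> 'u) \<Rightarrow> ('u \<Rightarrow> 'u \<Rightarrow> 'u) \<Rightarrow> ('u \<Rightarrow> 'u) \<Rightarrow> bool"
  where "algebra_automorphism s br \<theta> \<longleftrightarrow>
    Vector_Spaces.linear s s \<theta> \<and> bij \<theta> \<and> (\<forall>x y. \<theta> (br x y) = br (\<theta> x) (\<theta> y))"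

definition involutive_automorphism ::
  "('k::field \<Rightarrow> 'u::ab_group_add \<Rightarrow> 'u) \<Rightarrow> ('u \<Rightarrow> 'u \<Rightarrow> 'u) \<Rightarrow> ('u \<Rightarrow> 'u) \<Rightarrow> bool"
  where "involutive_automorphism s br \<theta> \<longleftrightarrow> algebra_automorphism s br \<theta> \<and> \<theta> \<circ> \<theta> = id"

locale universal_envelope =
  leibniz_triple_system sT triple + tensor_product sT sT sW tensor
  for sT :: "'k::field_char_0 \<Rightarrow> 't::ab_group_add \<Rightarrow> 't"
    and triple :: "'t \<Rightarrow> 't \<Rightarrow> 't \<Rightarrow> 't"
    and sW :: "'k \<Rightarrow> 'w::ab_group_add \<Rightarrow> 'w"
    and tensor :: "'t \<Rightarrow> 't \<Rightarrow> 'w"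
begin

sublocale U: vector_space_prod sT sW
  by unfold_locales

lemma linear_iffs:
  "Vector_Spaces.linear sT sT f \<longleftrightarrow>
    (\<forall>x y. f (x + y) = f x + f y) \<and> (\<forall>c x. f (sT c x) = sT c (f x))"
  "Vector_Spaces.linear sT sW g \<longleftrightarrow>
    (\<forall>x y. g (x + y) = g x + g y) \<and> (\<forall>c x. g (sT c x) = sW c (g x))"
  "Vector_Spaces.linear sW sT h \<longleftrightarrow>
    (\<forall>x y. h (x + y) = h x + h y) \<and> (\<forall>c x. h (sW c x) = sT c (h x))"
  "Vector_Spaces.linear sW sW k \<longleftrightarrow>
    (\<forall>x y. k (x + y) = k x + k y) \<and> (\<forall>c x. k (sW c x) = sW c (k x))"
  "Vector_Spaces.linear U.scale U.scale l \<longleftrightarrow>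
    (\<forall>x y. l (x + y) = l x + l y) \<and> (\<forall>c x. l (U.scale c x) = U.scale c (l x))"
  using vector_space_axioms W.vector_space_axioms U.p.vector_space_axioms
  by (simp_all add: Vector_Spaces.linear_iff)

lemma triple_simps:
  "triple (a + a') b c = triple a b c + triple a' b c"
  "triple a (b + b') c = triple a b c + triple a b' c"
  "triple a b (c + c') = triple a b c + triple a b c'"
  "triple (sT r a) b c = sT r (triple a b c)"
  "triple a (sT r b) c = sT r (triple a b c)"
  "triple a b (sT r c) = sT r (triple a b c)"
  using linear_triple1 linear_triple2 linear_triple3 by (auto simp: linear_iffs)

lemma tensor_simps:
  "tensor (a + a') b = tensor a b + tensor a' b"
  "tensor a (b + b') = tensor a b + tensor a b'"
  "tensor (sT r a) b = sW r (tensor a b)"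
  "tensor a (sT r b) = sW r (tensor a b)"
  using bilinear_tensor by (auto simp: is_bilinear_def linear_iffs)

lemma bilinear_TW: "is_bilinear sT sT sT (\<lambda>x y. triple x y c)"
  unfolding is_bilinear_def linear_iffs by (simp add: triple_simps)

lemma bilinear_WT: "is_bilinear sT sT sT (\<lambda>y z. triple a y z - triple a z y)"
  unfolding is_bilinear_def linear_iffs
  by (simp add: triple_simps algebra_simps)

lemma bilinear_WW:
  "is_bilinear sT sT sW (\<lambda>z w. tensor (triple x y z) w - tensor (triple x y w) z)"
  unfolding is_bilinear_def linear_iffs
  by (simp add: triple_simps tensor_simps algebra_simps)

lemma bilinear_WW':
  "is_bilinear sT sT sW (\<lambda>x y. tensor (triple x y z) w - tensor (triple x y w) z)"
  unfolding is_bilinear_def linear_iffs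
  by (simp add: triple_simps tensor_simps algebra_simps)

lemma bilinear_zero: "is_bilinear sT sT sT (\<lambda>_ _. 0)" "is_bilinear sT sT sW (\<lambda>_ _. 0)"
  unfolding is_bilinear_def linear_iffs by simp_all

lemmas VS = vector_space_axioms W.vector_space_axioms

lemma lift_add:
  assumes "vector_space sC" "is_bilinear sT sT sC f" "is_bilinear sT sT sC g"
    "is_bilinear sT sT sC h" "\<And>a b. h a b = f a b + g a b"
  shows "tensor_lift sW tensor sC h u = tensor_lift sW tensor sC f u + tensor_lift sW tensor sC g u"
proof -
  interpret P: vector_space_pair sW sC
    using assms(1) by (intro vector_space_pair.intro W.vector_space_axioms)
  have "tensor_lift sW tensor sC h
      = (\<lambda>u. tensor_lift sW tensor sC f u + tensor_lift sW tensor sC g u)"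
    by (rule linear_ext_tensor[of sC])
      (use assms in \<open>auto intro!: linear_tensor_lift P.linear_compose_add simp: tensor_lift_tensor\<close>)
  then show ?thesis by simp
qed

lemma lift_scale:
  assumes "vector_space sC" "is_bilinear sT sT sC f"
    "is_bilinear sT sT sC h" "\<And>a b. h a b = sC r (f a b)"
  shows "tensor_lift sW tensor sC h u = sC r (tensor_lift sW tensor sC f u)"
proof -
  interpret P: vector_space_pair sW sC
    using assms(1) by (intro vector_space_pair.intro W.vector_space_axioms)
  have "tensor_lift sW tensor sC h = (\<lambda>u. sC r (tensor_lift sW tensor sC f u))"
    by (rule linear_ext_tensor[of sC])
      (use assms in \<open>auto intro!: linear_tensor_lift P.linear_compose_scale_right simp: tensor_lift_tensor\<close>)
  then show ?thesis by simp
qed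

lemma bilinear_WW_outer:
  "is_bilinear sT sT sW (\<lambda>x y. tensor_lift sW tensor sW
     (\<lambda>z w. tensor (triple x y z) w - tensor (triple x y w) z) v)"
  unfolding is_bilinear_def linear_iffs
  by (intro conjI allI; (rule lift_add | rule lift_scale);
    (rule VS bilinear_WW | simp add: triple_simps tensor_simps algebra_simps))

lemma lift_linear_simps:
  assumes "vector_space sC" "is_bilinear sT sT sC f"
  shows "tensor_lift sW tensor sC f (u + v) = tensor_lift sW tensor sC f u + tensor_lift sW tensor sC f v"
    and "tensor_lift sW tensor sC f (sW r u) = sC r (tensor_lift sW tensor sC f u)"
    and "tensor_lift sW tensor sC f 0 = 0"
proof -
  interpret L: Vector_Spaces.linear sW sC "tensor_lift sW tensor sC f"
    by (rule linear_tensor_lift[OF assms])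
  show "tensor_lift sW tensor sC f (u + v) = tensor_lift sW tensor sC f u + tensor_lift sW tensor sC f v"
    "tensor_lift sW tensor sC f (sW r u) = sC r (tensor_lift sW tensor sC f u)"
    "tensor_lift sW tensor sC f 0 = 0"
    by (fact L.add L.scale L.zero)+
qed

lemma lift_zero:
  "tensor_lift sW tensor sT (\<lambda>_ _. 0) u = 0" "tensor_lift sW tensor sW (\<lambda>_ _. 0) u = 0"
  using lift_scale[OF VS(1) bilinear_zero(1) bilinear_zero(1), of 0 u]
    lift_scale[OF VS(2) bilinear_zero(2) bilinear_zero(2), of 0 u] by simp_all

lemma zero_simps: "triple 0 b c = 0" "triple a 0 c = 0" "triple a b 0 = 0"
  "tensor 0 b = 0" "tensor a 0 = 0"
  using triple_simps(1)[of 0 0] triple_simps(2)[of _ 0 0] triple_simps(3)[of _ _ 0 0]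
    tensor_simps(1)[of 0 0] tensor_simps(2)[of _ 0 0] by auto

lemma envelope_bracket_gens:
  shows "envelope_bracket sT triple sW tensor (a, 0) (b, 0) = (0, tensor a b)"
    and "envelope_bracket sT triple sW tensor (0, tensor a b) (c, 0) = (triple a b c, 0)"
    and "envelope_bracket sT triple sW tensor (a, 0) (0, tensor b c)
      = (triple a b c - triple a c b, 0)"
    and "envelope_bracket sT triple sW tensor (0, tensor a b) (0, tensor c d)
      = (0, tensor (triple a b c) d - tensor (triple a b d) c)"
  by (simp_all add: envelope_bracket_def lift_linear_simps[OF VS(1) bilinear_TW]
    lift_linear_simps[OF VS(1) bilinear_WT] lift_linear_simps[OF VS(2) bilinear_WW]
    tensor_lift_tensor[OF VS(1) bilinear_TW] tensor_lift_tensor[OF VS(1) bilinear_WT]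
    tensor_lift_tensor[OF VS(2) bilinear_WW] lift_linear_simps[OF VS(2) bilinear_WW']
    tensor_lift_tensor[OF VS(2) bilinear_WW'] lift_linear_simps[OF VS(2) bilinear_zero(2)]
    lift_zero zero_simps)

lemma bilinear_envelope_bracket:
  "is_bilinear U.scale U.scale U.scale (envelope_bracket sT triple sW tensor)"
proof -
  have 1: "tensor_lift sW tensor sT (\<lambda>x y. triple x y (c + d)) u
      = tensor_lift sW tensor sT (\<lambda>x y. triple x y c) u
      + tensor_lift sW tensor sT (\<lambda>x y. triple x y d) u"
    "tensor_lift sW tensor sT (\<lambda>x y. triple x y (sT r c)) u
      = sT r (tensor_lift sW tensor sT (\<lambda>x y. triple x y c) u)" for c d u r
    by ((rule lift_add | rule lift_scale);
      (rule VS bilinear_TW | simp add: triple_simps))+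
  have 2: "tensor_lift sW tensor sT (\<lambda>y z. triple (c + d) y z - triple (c + d) z y) u
      = tensor_lift sW tensor sT (\<lambda>y z. triple c y z - triple c z y) u
      + tensor_lift sW tensor sT (\<lambda>y z. triple d y z - triple d z y) u"
    "tensor_lift sW tensor sT (\<lambda>y z. triple (sT r c) y z - triple (sT r c) z y) u
      = sT r (tensor_lift sW tensor sT (\<lambda>y z. triple c y z - triple c z y) u)" for c d u r
    by ((rule lift_add | rule lift_scale);
      (rule VS bilinear_WT | simp add: triple_simps algebra_simps))+
  let ?N = "\<lambda>v. tensor_lift sW tensor sW (\<lambda>x y. tensor_lift sW tensor sW
     (\<lambda>z w. tensor (triple x y z) w - tensor (triple x y w) z) v)"
  have 3: "?N (v + v') u = ?N v u + ?N v' u" "?N (sW r v) u = sW r (?N v u)" for v v' u r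
    by ((rule lift_add | rule lift_scale);
      (rule VS bilinear_WW_outer | simp add: lift_linear_simps[OF VS(2) bilinear_WW]))+
  show ?thesis
    unfolding is_bilinear_def linear_iffs envelope_bracket_def
    by (simp add: U.scale_def lift_linear_simps(1,2)[OF VS(1) bilinear_TW]
      lift_linear_simps(1,2)[OF VS(1) bilinear_WT]
      lift_linear_simps(1,2)[OF VS(2) bilinear_WW_outer] 1 2 3 tensor_simps algebra_simps
      split: prod.splits)
qed

lemma leibniz_identity_imp:
  defines "br \<equiv> envelope_bracket sT triple sW tensor"
  assumes "\<And>x y z. br (br x y) z = br (br x z) y + br x (br y z)"
  shows "tensor a (triple b c d) = tensor (triple a b c) d - tensor (triple a c b) d
    - tensor (triple a d b) c + tensor (triple a d c) b"
proof -
  have diff: "tensor (u - v) w = tensor u w - tensor v w" for u v w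
    using tensor_simps(1)[of "u - v" v w] by (simp add: algebra_simps)
  show ?thesis
    using assms(2)[of "(a, 0)" "(0, tensor b c)" "(d, 0)"]
    by (simp add: br_def envelope_bracket_gens diff algebra_simps)
qed

end

end

theory Submission
  imports Defs
begin

text \<open>The bracket of \<open>U(T)\<close> is graded by \<open>\<int>/2\<close>, with odd part \<open>T\<close> and even part \<open>T \<otimes> T\<close>, so the
  parity map is an automorphism; its \<open>-1\<close>-eigenspace is \<open>T\<close> because \<open>2\<close> is invertible. Conversely,
  an automorphism that is \<open>-1\<close> on \<open>T\<close> fixes every \<open>[a, b] = a \<otimes> b\<close>, hence all of \<open>T \<otimes> T\<close>.\<close>

definition parity :: "'t::ab_group_add \<times> 'w::ab_group_add \<Rightarrow> 't \<times> 'w"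
  where "parity x = (- fst x, snd x)"

context universal_envelope
begin

text \<open>Negation is scaling by \<open>- 1\<close>, so \<open>lift_scale\<close> moves the sign
  out of the lift.\<close>

lemma lift_minus:
  assumes "vector_space sC" "is_bilinear sT sT sC f"
  shows "tensor_lift sW tensor sC (\<lambda>a b. - f a b) u = - tensor_lift sW tensor sC f u"
proof -
  interpret C: vector_space sC by fact
  have "is_bilinear sT sT sC (\<lambda>a b. - f a b)"
    using assms(2) by (simp add: is_bilinear_def Vector_Spaces.linear_iff)
  then have "tensor_lift sW tensor sC (\<lambda>a b. - f a b) u = sC (- 1) (tensor_lift sW tensor sC f u)"
    using assms by (intro lift_scale) simp_all
  then show ?thesis by simp
qed

lemma triple_minus:
  "triple (- a) b c = - triple a b c"
  "triple a (- b) c = - triple a b c"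
  "triple a b (- c) = - triple a b c"
  using triple_simps(4-6)[where r = "- 1"] by simp_all

lemma tensor_minus: "tensor (- a) b = - tensor a b" "tensor a (- b) = - tensor a b"
  using tensor_simps(3,4)[where r = "- 1"] by simp_all

text \<open>Count signs by odd factors: both summands of the first component contain exactly one, so
  they change sign. In the second component, \<open>tensor a c\<close> picks up two signs that
  cancel, and the product of the even parts picks up none.\<close>

lemma envelope_bracket_parity:
  "envelope_bracket sT triple sW tensor (parity x) (parity y)
    = parity (envelope_bracket sT triple sW tensor x y)"
proof -
  have "tensor_lift sW tensor sT (\<lambda>y z. triple (- a) y z - triple (- a) z y) v
      = - tensor_lift sW tensor sT (\<lambda>y z. triple a y z - triple a z y) v" for a v
    using lift_minus[OF VS(1) bilinear_WT] by (simp add: triple_minus)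
  then show ?thesis
    by (simp add: envelope_bracket_def parity_def triple_minus tensor_minus
      lift_minus[OF VS(1) bilinear_TW] split: prod.splits)
qed

lemma involutive_automorphism_parity:
  "involutive_automorphism U.scale (envelope_bracket sT triple sW tensor) parity"
proof -
  have inv: "parity \<circ> parity = (id :: 't \<times> 'w \<Rightarrow> 't \<times> 'w)"
    by (simp add: fun_eq_iff parity_def)
  have "Vector_Spaces.linear U.scale U.scale parity"
    unfolding linear_iffs by (simp add: parity_def U.scale_def)
  then show ?thesis
    using inv o_bij[OF inv inv]
    by (simp add: involutive_automorphism_def algebra_automorphism_def envelope_bracket_parity)
qed

text \<open>The first components always agree. The second ones give \<open>u = - u\<close>, that is
  \<open>sW 2 u = 0\<close>, and 2 is nonzero in characteristic 0.\<close>

lemma parity_eq_minus_iff: "parity x = - (x :: 't \<times> 'w) \<longleftrightarrow> snd x = 0"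
proof -
  have "u = 0" if "u = - u" for u :: 'w
  proof -
    have "sW 2 u = u + u"
      using W.scale_left_distrib[of 1 1 u] by simp
    also have "\<dots> = 0"
      using that by (metis add.right_inverse)
    finally show ?thesis by simp
  qed
  then show ?thesis
    by (auto simp: parity_def prod_eq_iff)
qed

lemma algebra_automorphism_eq_parity:
  assumes "algebra_automorphism U.scale (envelope_bracket sT triple sW tensor) \<theta>"
    and odd: "\<And>a. \<theta> (a, 0) = (- a, 0)"
  shows "\<theta> = parity"
proof
  have lin: "Vector_Spaces.linear U.scale U.scale \<theta>"
    and hom: "\<And>x y. \<theta> (envelope_bracket sT triple sW tensor x y)
      = envelope_bracket sT triple sW tensor (\<theta> x) (\<theta> y)"
    using assms(1) unfolding algebra_automorphism_def by blast+
  have add: "\<theta> (x + y) = \<theta> x + \<theta> y" for x y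
    using lin unfolding linear_iffs by blast
  \<comment> \<open>The signs of \<open>- a\<close> and \<open>- b\<close> cancel in the bracket of
    their images.\<close>
  have gen: "\<theta> (0, tensor a b) = (0, tensor a b)" for a b
    using hom[of "(a, 0)" "(b, 0)"] by (simp add: odd envelope_bracket_gens tensor_minus)
  \<comment> \<open>Not every element of the even part is a pure tensor. The inclusion of
    \<open>'w\<close> and its composite with \<theta> are therefore compared as linear maps, which
    coincide once they agree on pure tensors.\<close>
  have "Vector_Spaces.linear sW U.scale (\<lambda>u. (0, u))"
    using VS U.p.vector_space_axioms by (simp add: Vector_Spaces.linear_iff U.scale_def)
  moreover from this have "Vector_Spaces.linear sW U.scale (\<lambda>u. \<theta> (0, u))"
    using Vector_Spaces.linear_compose[OF _ lin] by (simp add: comp_def)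
  ultimately have "(\<lambda>u. \<theta> (0, u)) = (\<lambda>u. (0, u))"
    using gen by (intro linear_ext_tensor[of U.scale]) simp_all
  then have even: "\<theta> (0, u) = (0, u)" for u
    by metis
  show "\<theta> x = parity x" for x
    using add[of "(fst x, 0)" "(0, snd x)"] by (simp add: odd even parity_def)
qed

end

theorem theorem3p1:
  fixes scale :: "'k::field_char_0 \<Rightarrow> 't::ab_group_add \<Rightarrow> 't"
    and triple :: "'t \<Rightarrow> 't \<Rightarrow> 't \<Rightarrow> 't"
    and scaleTT :: "'k \<Rightarrow> 'w::ab_group_add \<Rightarrow> 'w"
    and tensor :: "'t \<Rightarrow> 't \<Rightarrow> 'w"
  assumes "leibniz_triple_system scale triple"
    and "tensor_product scale scale scaleTT tensor"
  shows "\<exists>!\<theta> :: 't \<times> 'w \<Rightarrow> 't \<times> 'w.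
    involutive_automorphism (module_prod.scale scale scaleTT)
      (envelope_bracket scale triple scaleTT tensor) \<theta> \<and>
    range (\<lambda>a. (a, 0)) = {x. \<theta> x = - x}"
proof -
  interpret universal_envelope scale triple scaleTT tensor
    using assms by (rule universal_envelope.intro)
  show ?thesis
  proof (rule ex1I[of _ parity], intro conjI)
    show "involutive_automorphism U.scale (envelope_bracket scale triple scaleTT tensor) parity"
      by (rule involutive_automorphism_parity)
    show "range (\<lambda>a. (a, 0)) = {x :: 't \<times> 'w. parity x = - x}"
      by (auto simp: parity_eq_minus_iff)
  next
    fix \<theta> :: "'t \<times> 'w \<Rightarrow> 't \<times> 'w"
    assume \<theta>: "involutive_automorphism U.scale (envelope_bracket scale triple scaleTT tensor) \<theta> \<and>
      range (\<lambda>a. (a, 0)) = {x. \<theta> x = - x}"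
    \<comment> \<open>The inclusion of the odd part in the eigenspace prescribes \<theta> on
      generators of the algebra.\<close>
    then have "(a, 0) \<in> {x. \<theta> x = - x}" for a
      by (metis rangeI)
    then have "\<theta> (a, 0) = (- a, 0)" for a
      by simp
    with \<theta> show "\<theta> = parity"
      by (intro algebra_automorphism_eq_parity) (simp_all add: involutive_automorphism_def)
  qed
qed

end
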